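(* If $\varphi(x)$ is a candidate function (of relative degree one, so that $\varphi(x,u)\equiv\varphi(x)$) such that $\varphi(x(0))\ge 0$, $L_f\varphi(x)\ge 0$ for all $x\in X$, and $L_g\varphi(x)=\gamma L_gb(x)$ for all $x\in X$ for some $\gamma>0$, and if $0\in U$, then any controller $u(t)\in U_s(x(t))$, for all $t\ge 0$, guarantees the feasibility of problem (P).
   Context: System: $\dot x=f(x)+g(x)u$, $x\in X\subset\mathbb R^n$, with $f:\mathbb R^n\to\mathbb R^n$ and $g:\mathbb R^n\to\mathbb R^{n\times q}$ locally Lipschitz, and $u\in U=\{u\in\mathbb R^q: u_{\min}\le u\le u_{\max}\}$ (componentwise inequalities, $u_{\min},u_{\max}\in\mathbb R^q$). $x(0)$ is the initial state and $x(t)$ the resulting solution. $L_f,L_g$ are Lie derivatives along $f,g$; for a scalar function $h$, $L_gh(x)\in\mathbb R^{1\times q}$. The relative degree of a (sufficiently many times) differentiable function with respect to the system is the number of times it must be differentiated along the dynamics until $u$ appears explicitly (zero if $u$ appears in the function itself). Class $\mathcal K$ function: continuous, strictly increasing $\alpha:[0,a)\to[0,\infty)$, $a>0$, with $\alpha(0)=0$; where such a function is evaluated at other real arguments, it is understood to be a continuous strictly increasing function on $\mathbb R$ vanishing at $0$. Safety constraint: $b(x)\ge 0$, where $b:\mathbb R^n\to\mathbb R$ is continuously differentiable and has relative degree one. Standing assumption: no component of $L_gb(x)$ changes sign, and $L_gb(x)\le 0$ (componentwise) for all $x\in X$. With a class $\mathcal K$ function $\alpha$, the controls satisfying the control barrier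 function (CBF) constraint are $$K(x)=\{u\in\mathbb R^q: -L_gb(x)u\le L_fb(x)+\alpha(b(x))\}.$$ Problem (P): minimize over $u(t),\delta(t)$ the cost $\int_0^T\left(\|u(t)\|^2+p\,\delta^2(t)\right)dt$ ($T>0$) subject to (i) $u\in K(x)$; (ii) $L_fV(x)+L_gV(x)u+\epsilon V(x)\le\delta(t)$, where $V(x)=\|x-x^\ast\|^2$ for a given target point $x^\ast\in\mathbb R^n$; (iii) $u\in U$. Here $p>0$, $\epsilon>0$, and $\delta$ is a free real relaxation variable. The problem is solved point-wise in time along the trajectory; it is feasible at a given state $x$ if the constraints (i)-(iii) at that $x$ define a non-empty set for $(u,\delta)$, and guaranteeing its feasibility means that it is feasible at the states $x(t)$ along the resulting trajectory. Define $b_F(x)=L_fb(x)+\alpha(b(x))+L_gb(x)u_{\min}$ and, with a class $\mathcal K$ function $\alpha_f$, $$K_F(x)=\{u\in\mathbb R^q: L_fb_F(x)+L_gb_F(x)u+\alpha_f(b_F(x))\ge 0\}.$$ Let $\varphi(x,u)$ be a function such that the constraint defining $K_F(x)$ is rewritten in the form $$L_fb(x)+L_gb(x)u+\alpha(b(x))+\varphi(x,u)\ge 0$$ (for example $\varphi=L_fb_F+L_gb_F\,u+\alpha_f(b_F)-L_fb-L_gb\,u-\alpha(b)$). Such a $\varphi$ is called a candidate function if its relative degree with respect to the system is either one or zero. When the relative degree is one, $\varphi(x,u)\equiv\varphi(x)$, and with a class $\mathcal K$ function $\alpha_u$, $$U_s(x)=\{u\in\mathbb R^q: L_f\varphi(x)+L_g\varphi(x)u+\alpha_u(\varphi(x))\ge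 0\}.$$
   Formalization: Added, since the claim is false without them: (P) is feasible at x(0), and the controller satisfies the CBF constraint u(t) in K(x(t)) for all t≥0; also b_F is assumed continuously differentiable, so that its Lie derivatives in K_F make sense. *)

theory Defs
  imports "HOL-Analysis.Analysis"
begin

definition continuously_differentiable :: "('a::real_normed_vector \<Rightarrow> real) \<Rightarrow> bool" where
  "continuously_differentiable h \<longleftrightarrow>
     (\<exists>h'. (\<forall>x. (h has_derivative blinfun_apply (h' x)) (at x)) \<and> continuous_on UNIV h')"

(* Class-K functions are applied to values of either sign, so they are functions on the whole line. *)
definition class_K :: "(real \<Rightarrow> real) \<Rightarrow> bool" where
  "class_K \<alpha> \<longleftrightarrow> continuous_on UNIV \<alpha> \<and> strict_mono \<alpha> \<and> \<alpha> 0 = 0"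

definition lie_f :: "(real^'n \<Rightarrow> real^'n) \<Rightarrow> (real^'n \<Rightarrow> real) \<Rightarrow> real^'n \<Rightarrow> real" where
  "lie_f f h x = frechet_derivative h (at x) (f x)"

(* The row vector L_g h(x), one entry for each column of g(x); the product L_g h(x) u is the
   inner product of lie_g g h x and u. *)
definition lie_g :: "(real^'n \<Rightarrow> real^'q^'n) \<Rightarrow> (real^'n \<Rightarrow> real) \<Rightarrow> real^'n \<Rightarrow> real^'q" where
  "lie_g g h x = (\<chi> j. frechet_derivative h (at x) (column j (g x)))"

(* Caratheodory solutions in X, defined for all t \<ge> 0. For a continuous control these are the
   classical solutions; discontinuous controls are allowed. *)
definition is_trajectory ::
  "(real^'n \<Rightarrow> real^'n) \<Rightarrow> (real^'n \<Rightarrow> real^'q^'n) \<Rightarrow> (real^'n) set \<Rightarrow>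
   (real \<Rightarrow> real^'q) \<Rightarrow> (real \<Rightarrow> real^'n) \<Rightarrow> bool" where
  "is_trajectory f g X u x \<longleftrightarrow>
     (\<forall>t\<ge>0. x t \<in> X \<and>
        (\<lambda>s. f (x s) + g (x s) *v u s) absolutely_integrable_on {0..t} \<and>
        x t = x 0 + integral {0..t} (\<lambda>s. f (x s) + g (x s) *v u s))"

(* The number of differentiations along the dynamics after which the control appears; degree 0
   means that F itself depends on the control at some state of X. *)
primrec has_relative_degree ::
  "(real^'n \<Rightarrow> real^'n) \<Rightarrow> (real^'n \<Rightarrow> real^'q^'n) \<Rightarrow> (real^'n) set \<Rightarrow>
   nat \<Rightarrow> (real^'n \<Rightarrow> real^'q \<Rightarrow> real) \<Rightarrow> bool" where
  "has_relative_degree f g X 0 F \<longleftrightarrow> (\<exists>x\<in>X. \<exists>u v. F x u \<noteq> F x v)"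
| "has_relative_degree f g X (Suc k) F \<longleftrightarrow>
     (\<exists>h. F = (\<lambda>x u. h x) \<and> continuously_differentiable h \<and>
          has_relative_degree f g X k (\<lambda>x u. lie_f f h x + lie_g g h x \<bullet> u))"

definition K_cbf ::
  "(real^'n \<Rightarrow> real^'n) \<Rightarrow> (real^'n \<Rightarrow> real^'q^'n) \<Rightarrow> (real^'n \<Rightarrow> real) \<Rightarrow>
   (real \<Rightarrow> real) \<Rightarrow> real^'n \<Rightarrow> (real^'q) set" where
  "K_cbf f g b \<alpha> x = {u. - (lie_g g b x \<bullet> u) \<le> lie_f f b x + \<alpha> (b x)}"

definition V :: "real^'n \<Rightarrow> real^'n \<Rightarrow> real" where
  "V x_star x = (norm (x - x_star))\<^sup>2"

(* The order on vectors is componentwise, so {u_min..u_max} is the box of admissible controls.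
   The cost, hence also its weight p and horizon T, plays no role in feasibility at a state. *)
definition P_feasible_at ::
  "(real^'n \<Rightarrow> real^'n) \<Rightarrow> (real^'n \<Rightarrow> real^'q^'n) \<Rightarrow> real^'q \<Rightarrow> real^'q \<Rightarrow>
   (real^'n \<Rightarrow> real) \<Rightarrow> (real \<Rightarrow> real) \<Rightarrow> real^'n \<Rightarrow> real \<Rightarrow> real^'n \<Rightarrow> bool" where
  "P_feasible_at f g u_min u_max b \<alpha> x_star \<epsilon> x \<longleftrightarrow>
     (\<exists>u (\<delta>::real).
        u \<in> K_cbf f g b \<alpha> x \<and>
        lie_f f (V x_star) x + lie_g g (V x_star) x \<bullet> u + \<epsilon> * V x_star x \<le> \<delta> \<and>
        u \<in> {u_min..u_max})"

definition b_F ::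
  "(real^'n \<Rightarrow> real^'n) \<Rightarrow> (real^'n \<Rightarrow> real^'q^'n) \<Rightarrow> real^'q \<Rightarrow>
   (real^'n \<Rightarrow> real) \<Rightarrow> (real \<Rightarrow> real) \<Rightarrow> real^'n \<Rightarrow> real" where
  "b_F f g u_min b \<alpha> x = lie_f f b x + \<alpha> (b x) + lie_g g b x \<bullet> u_min"

definition K_F ::
  "(real^'n \<Rightarrow> real^'n) \<Rightarrow> (real^'n \<Rightarrow> real^'q^'n) \<Rightarrow> real^'q \<Rightarrow>
   (real^'n \<Rightarrow> real) \<Rightarrow> (real \<Rightarrow> real) \<Rightarrow> (real \<Rightarrow> real) \<Rightarrow> real^'n \<Rightarrow> (real^'q) set" where
  "K_F f g u_min b \<alpha> \<alpha>_f x =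
     {u. lie_f f (b_F f g u_min b \<alpha>) x + lie_g g (b_F f g u_min b \<alpha>) x \<bullet> u
           + \<alpha>_f (b_F f g u_min b \<alpha> x) \<ge> 0}"

(* Any phi for which the displayed inequality is, on X, the constraint defining K_F. *)
definition candidate_function ::
  "(real^'n \<Rightarrow> real^'n) \<Rightarrow> (real^'n \<Rightarrow> real^'q^'n) \<Rightarrow> (real^'n) set \<Rightarrow> real^'q \<Rightarrow>
   (real^'n \<Rightarrow> real) \<Rightarrow> (real \<Rightarrow> real) \<Rightarrow> (real \<Rightarrow> real) \<Rightarrow>
   (real^'n \<Rightarrow> real^'q \<Rightarrow> real) \<Rightarrow> bool" where
  "candidate_function f g X u_min b \<alpha> \<alpha>_f \<phi> \<longleftrightarrow>
     (\<forall>x\<in>X. K_F f g u_min b \<alpha> \<alpha>_f x =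
        {u. lie_f f b x + lie_g g b x \<bullet> u + \<alpha> (b x) + \<phi> x u \<ge> 0}) \<and>
     (has_relative_degree f g X 0 \<phi> \<or> has_relative_degree f g X 1 \<phi>)"

definition U_s ::
  "(real^'n \<Rightarrow> real^'n) \<Rightarrow> (real^'n \<Rightarrow> real^'q^'n) \<Rightarrow> (real^'n \<Rightarrow> real) \<Rightarrow>
   (real \<Rightarrow> real) \<Rightarrow> real^'n \<Rightarrow> (real^'q) set" where
  "U_s f g \<phi> \<alpha>_u x = {u. lie_f f \<phi> x + lie_g g \<phi> x \<bullet> u + \<alpha>_u (\<phi> x) \<ge> 0}"

end

theory Submission
  imports Defs
begin

text \<open>
  Since \<open>L\<^sub>gb \<le> 0\<close>, the control \<open>u_min\<close> is the best one for the barrier constraint, so (P) is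
  feasible at \<open>x\<close> iff \<open>b_F x \<ge> 0\<close>. The controls in \<open>U_s\<close> keep \<open>\<phi> \<ge> 0\<close> along the trajectory; where
  \<open>\<phi> \<ge> 0\<close>, every control in \<open>K\<close> lies in \<open>K_F\<close>, and controls in \<open>K_F\<close> keep \<open>b_F \<ge> 0\<close>. Both
  invariance steps rest on the fundamental theorem of calculus for a \<open>C\<^sup>1\<close> function composed with
  an absolutely continuous curve.
\<close>

text \<open>
  The gauge is fine enough for two purposes: near a tag \<open>s\<close> the linearisation of \<open>h\<close> at \<open>x s\<close>
  has error at most \<open>\<eta>\<close> times the increment of \<open>x\<close>, and by Henstock's lemma the increments of \<open>x\<close>
  are close to those of its linearisation with slope \<open>v s\<close>. The total variation of \<open>x\<close> is at most
  the integral of \<open>norm v\<close>, which makes the first kind of error summable.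
\<close>
lemma has_integral_C1_compose_indefinite_integral:
  fixes h :: "'a::euclidean_space \<Rightarrow> 'b::real_normed_vector" and v x :: "real \<Rightarrow> 'a"
  assumes "a \<le> b"
    and v: "v absolutely_integrable_on {a..b}"
    and x: "\<And>c d. a \<le> c \<Longrightarrow> c \<le> d \<Longrightarrow> d \<le> b \<Longrightarrow> x d - x c = integral {c..d} v"
    and h: "\<And>y. (h has_derivative blinfun_apply (h' y)) (at y)"
    and h': "continuous_on UNIV h'"
  shows "((\<lambda>s. h' (x s) (v s)) has_integral h (x b) - h (x a)) {a..b}"
  unfolding has_integral_real
proof (intro allI impI)
  fix e :: real assume "e > 0"
  have vi: "v integrable_on {a..b}" and nvi: "(\<lambda>s. norm (v s)) integrable_on {a..b}"
    using v by (auto simp: absolutely_integrable_on_def)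
  define L where "L = integral {a..b} (\<lambda>s. norm (v s))"
  have "L \<ge> 0"
    unfolding L_def by (rule integral_nonneg[OF nvi]) auto
  have "continuous_on {a..b} (\<lambda>t. x a + integral {a..t} v)"
    by (intro continuous_intros indefinite_integral_continuous_1 vi)
  then have cx: "continuous_on {a..b} x"
    by (rule continuous_on_eq) (use x[of a] in \<open>auto simp flip: x\<close>)
  then have "continuous_on {a..b} (\<lambda>s. h' (x s))"
    using continuous_on_compose2[OF h'] by auto
  then have "bounded ((\<lambda>s. h' (x s)) ` {a..b})"
    by (intro compact_imp_bounded compact_continuous_image) auto
  then obtain M where "M > 0" and M: "\<And>s. s \<in> {a..b} \<Longrightarrow> norm (h' (x s)) \<le> M"
    unfolding bounded_pos by blast
  \<comment> \<open>The linearisation errors add up to at most \<eta> times \<open>L\<close>, so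
    this choice gives them half of \<open>e\<close>; the \<open>+ 1\<close> covers the case
    \<open>L = 0\<close>.\<close>
  define \<eta> where "\<eta> = e / (2 * (L + 1))"
  have "\<eta> > 0" using \<open>e > 0\<close> \<open>L \<ge> 0\<close> by (simp add: \<eta>_def)
  \<comment> \<open>Both \<open>c\<close> and \<open>d\<close> may differ from \<open>s\<close>, so
    the derivative at one point must control the increment between two others. Continuity of
    \<open>h'\<close> makes it nearly constant on a ball around \<open>x s\<close>, where the mean
    value inequality applies.\<close>
  have "\<exists>r>0. \<forall>c d. a \<le> c \<longrightarrow> c \<le> b \<longrightarrow> a \<le> d \<longrightarrow> d \<le> b \<longrightarrow> c \<in> ball s r \<longrightarrow> d \<in> ball s r \<longrightarrow>
      norm (h (x d) - h (x c) - h' (x s) (x d - x c)) \<le> norm (x d - x c) * \<eta>"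
    if s: "s \<in> {a..b}" for s
  proof -
    obtain \<rho> where "\<rho> > 0" and \<rho>: "\<And>y. dist y (x s) < \<rho> \<Longrightarrow> dist (h' y) (h' (x s)) < \<eta>"
      using h' \<open>\<eta> > 0\<close> unfolding continuous_on_iff by (metis UNIV_I)
    obtain r where "r > 0" and r: "\<And>t. t \<in> {a..b} \<Longrightarrow> dist t s < r \<Longrightarrow> dist (x t) (x s) < \<rho>"
      using cx s \<open>\<rho> > 0\<close> unfolding continuous_on_iff by metis
    have "norm (h z - h y - h' (x s) (z - y)) \<le> norm (z - y) * \<eta>"
      if "y \<in> ball (x s) \<rho>" "z \<in> ball (x s) \<rho>" for y z
    proof (rule differentiable_bound_linearization[where S = "ball (x s) \<rho>"
          and f' = "\<lambda>y. blinfun_apply (h' y)"])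
      show "y + t *\<^sub>R (z - y) \<in> ball (x s) \<rho>" if "t \<in> {0..1}" for t
        using convexD_alt[OF convex_ball \<open>y \<in> _\<close> \<open>z \<in> _\<close>, of t] that by (simp add: algebra_simps)
      show "(h has_derivative h' w) (at w within ball (x s) \<rho>)" for w
        using h by (rule has_derivative_at_withinI)
      show "onorm (blinfun_apply (h' w) - blinfun_apply (h' (x s))) \<le> \<eta>" if "w \<in> ball (x s) \<rho>" for w
        using \<rho>[of w] that
        by (simp add: dist_norm norm_blinfun.rep_eq minus_blinfun.rep_eq fun_diff_def norm_minus_commute)
      show "x s \<in> ball (x s) \<rho>" using \<open>\<rho> > 0\<close> by simp
    qed
    then show ?thesis
      using \<open>r > 0\<close> r by (intro exI[of _ r]) (auto simp: dist_commute)
  qed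
  then obtain r where r: "\<And>s. s \<in> {a..b} \<Longrightarrow> r s > 0"
    and lin: "\<And>s c d. \<lbrakk>s \<in> {a..b}; a \<le> c; c \<le> b; a \<le> d; d \<le> b; c \<in> ball s (r s); d \<in> ball s (r s)\<rbrakk> \<Longrightarrow>
      norm (h (x d) - h (x c) - h' (x s) (x d - x c)) \<le> norm (x d - x c) * \<eta>"
    by metis
  \<comment> \<open>A gauge needs a neighbourhood of every real number; outside the interval, where
    nothing is known about \<open>r\<close>, any positive radius will do.\<close>
  define \<gamma>1 where "\<gamma>1 s = ball s (if s \<in> {a..b} then r s else 1)" for s
  have "gauge \<gamma>1"
    using r by (auto simp: gauge_def \<gamma>1_def)
  \<comment> \<open>The Henstock errors pass through the maps \<open>h' (x s)\<close>, of norm at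
    most \<open>M\<close>, and so cost the other half of \<open>e\<close>.\<close>
  have "e / (2 * M) > 0" using \<open>e > 0\<close> \<open>M > 0\<close> by simp
  then obtain \<gamma>2 where "gauge \<gamma>2" and
    \<gamma>2: "\<And>p. \<lbrakk>p tagged_partial_division_of (cbox a b); \<gamma>2 fine p\<rbrakk> \<Longrightarrow>
             (\<Sum>(s,K)\<in>p. norm (measure lborel K *\<^sub>R v s - integral K v)) < e / (2 * M)"
    using Henstock_lemma[of v a b "e / (2 * M)"] vi by auto
  show "\<exists>\<gamma>. gauge \<gamma> \<and> (\<forall>p. p tagged_division_of {a..b} \<and> \<gamma> fine p \<longrightarrow>
      norm ((\<Sum>(s,K)\<in>p. measure lborel K *\<^sub>R h' (x s) (v s)) - (h (x b) - h (x a))) < e)"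
  proof (intro exI[of _ "\<lambda>s. \<gamma>1 s \<inter> \<gamma>2 s"] conjI allI impI)
    show "gauge (\<lambda>s. \<gamma>1 s \<inter> \<gamma>2 s)"
      using \<open>gauge \<gamma>1\<close> \<open>gauge \<gamma>2\<close> by blast
    fix p assume "p tagged_division_of {a..b} \<and> (\<lambda>s. \<gamma>1 s \<inter> \<gamma>2 s) fine p"
    then have p: "p tagged_division_of {a..b}" and fine: "\<gamma>1 fine p" "\<gamma>2 fine p"
      by (auto simp: fine_Int)
    \<comment> \<open>Compare both terms with \<open>h' (x s) (integral K v)\<close>, the derivative
      at the tag applied to the true increment of \<open>x\<close> over \<open>K\<close>: the first
      difference is a Henstock error, the second a linearisation error.\<close>
    have tag: "norm (measure lborel K *\<^sub>R h' (x s) (v s) - (h (x (Sup K)) - h (x (Inf K)))) \<le>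
        M * norm (measure lborel K *\<^sub>R v s - integral K v) + \<eta> * integral K (\<lambda>s. norm (v s))"
      if sK: "(s, K) \<in> p" for s K
    proof -
      obtain c d where K: "K = {c..d}"
        using tagged_division_ofD(4)[OF p sK] by auto
      have "s \<in> K" "K \<subseteq> {a..b}" using tagged_division_ofD(2,3)[OF p sK] by auto
      then have cd: "c \<le> d" "a \<le> c" "d \<le> b" "s \<in> {a..b}" using K by auto
      have sub: "v integrable_on {c..d}" "(\<lambda>s. norm (v s)) integrable_on {c..d}"
        using vi nvi cd by (auto intro: integrable_on_subinterval)
      have xcd: "x d - x c = integral K v"
        using x cd K by simp
      have "K \<subseteq> \<gamma>1 s" using fine(1) sK by (auto simp: fine_def)
      then have "c \<in> ball s (r s)" "d \<in> ball s (r s)"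
        using cd K by (auto simp: \<gamma>1_def subset_iff)
      then have "norm (h (x d) - h (x c) - h' (x s) (integral K v)) \<le> norm (integral K v) * \<eta>"
        using lin[of s c d] cd xcd by simp
      also have "\<dots> \<le> \<eta> * integral K (\<lambda>s. norm (v s))"
        using integral_norm_bound_integral[OF sub] \<open>\<eta> > 0\<close> K by (simp add: mult.commute)
      finally have 1: "norm (h (x d) - h (x c) - h' (x s) (integral K v)) \<le> \<eta> * integral K (\<lambda>s. norm (v s))" .
      have "norm (h' (x s) (measure lborel K *\<^sub>R v s - integral K v)) \<le>
          norm (h' (x s)) * norm (measure lborel K *\<^sub>R v s - integral K v)"
        by (rule norm_blinfun)
      also have "\<dots> \<le> M * norm (measure lborel K *\<^sub>R v s - integral K v)"
        using M[OF cd(4)] by (intro mult_right_mono) auto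
      finally have 2: "norm (h' (x s) (measure lborel K *\<^sub>R v s - integral K v)) \<le>
          M * norm (measure lborel K *\<^sub>R v s - integral K v)" .
      have "measure lborel K *\<^sub>R h' (x s) (v s) - (h (x (Sup K)) - h (x (Inf K))) =
          h' (x s) (measure lborel K *\<^sub>R v s - integral K v) - (h (x d) - h (x c) - h' (x s) (integral K v))"
        using cd K by (simp add: blinfun.bilinear_simps)
      then show ?thesis
        using norm_triangle_ineq4 1 2 by (smt (verit))
    qed
    have "(\<Sum>(s,K)\<in>p. h (x (Sup K)) - h (x (Inf K))) = h (x b) - h (x a)"
      using additive_tagged_division_1[OF \<open>a \<le> b\<close> p, of "\<lambda>t. h (x t)"] .
    then have "norm ((\<Sum>(s,K)\<in>p. measure lborel K *\<^sub>R h' (x s) (v s)) - (h (x b) - h (x a))) =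
        norm (\<Sum>(s,K)\<in>p. measure lborel K *\<^sub>R h' (x s) (v s) - (h (x (Sup K)) - h (x (Inf K))))"
      by (simp add: case_prod_unfold sum_subtractf)
    also have "\<dots> \<le> (\<Sum>(s,K)\<in>p. M * norm (measure lborel K *\<^sub>R v s - integral K v) + \<eta> * integral K (\<lambda>s. norm (v s)))"
      using tag by (intro sum_norm_le) auto
    also have "\<dots> = M * (\<Sum>(s,K)\<in>p. norm (measure lborel K *\<^sub>R v s - integral K v))
        + \<eta> * (\<Sum>(s,K)\<in>p. integral K (\<lambda>s. norm (v s)))"
      by (simp add: case_prod_unfold sum.distrib sum_distrib_left)
    also have "(\<Sum>(s,K)\<in>p. integral K (\<lambda>s. norm (v s))) = L"
      using integral_combine_tagged_division_topdown[of "\<lambda>s. norm (v s)" a b p] nvi p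
      by (simp add: L_def)
    also have "M * (\<Sum>(s,K)\<in>p. norm (measure lborel K *\<^sub>R v s - integral K v)) < M * (e / (2 * M))"
      using \<gamma>2[of p] p fine \<open>M > 0\<close> by (intro mult_strict_left_mono) (auto simp: tagged_division_of_def)
    also have "\<eta> * L \<le> e / 2"
      using \<open>e > 0\<close> \<open>L \<ge> 0\<close> by (simp add: \<eta>_def field_simps)
    finally show "norm ((\<Sum>(s,K)\<in>p. measure lborel K *\<^sub>R h' (x s) (v s)) - (h (x b) - h (x a))) < e"
      using \<open>M > 0\<close> by simp
  qed
qed

text \<open>The product \<open>g y *v w\<close> combines the columns of \<open>g y\<close> with the
  entries of \<open>w\<close> as weights, and the derivative is linear. Constraints in Lie
  derivatives thereby become statements about the derivative of \<open>h\<close> along the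
  velocity.\<close>

lemma lie_f_plus_lie_g:
  assumes "(h has_derivative h') (at y)"
  shows "lie_f f h y + lie_g g h y \<bullet> w = h' (f y + g y *v w)"
proof -
  have lin: "linear h'" using assms by (rule has_derivative_linear)
  have "frechet_derivative h (at y) = h'"
    using frechet_derivative_at[OF assms] by simp
  then have "lie_f f h y + lie_g g h y \<bullet> w = h' (f y) + (\<Sum>j\<in>UNIV. w $ j * h' (column j (g y)))"
    by (simp add: lie_f_def lie_g_def inner_vec_def mult.commute)
  also have "\<dots> = h' (f y + g y *v w)"
    by (simp add: matrix_mult_sum linear_add[OF lin] linear_sum[OF lin] scalar_mult_eq_scaleR
        linear_scale[OF lin])
  finally show ?thesis .
qed

text \<open>If \<open>h\<close> were negative at time \<open>t\<close>, let \<open>c\<close> be the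
  last earlier time with a nonnegative value. After \<open>c\<close>, \<open>h\<close> and hence
  \<beta> of it are negative, so the barrier condition makes the derivative of \<open>h\<close>
  along the velocity positive. Integrating from \<open>c\<close> to \<open>t\<close> shows that
  \<open>h\<close> cannot have dropped below its value at \<open>c\<close>.\<close>

lemma is_trajectory_nonneg_invariant:
  assumes traj: "is_trajectory f g X u x"
    and C1: "continuously_differentiable h"
    and \<beta>: "class_K \<beta>"
    and init: "h (x 0) \<ge> 0"
    and barrier: "\<And>t. t \<ge> 0 \<Longrightarrow> lie_f f h (x t) + lie_g g h (x t) \<bullet> u t + \<beta> (h (x t)) \<ge> 0"
    and "t \<ge> 0"
  shows "h (x t) \<ge> 0"
proof (rule ccontr)
  assume neg: "\<not> h (x t) \<ge> 0"
  define v where "v s = f (x s) + g (x s) *v u s" for s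
  have v: "v absolutely_integrable_on {0..s}" and xs: "x s = x 0 + integral {0..s} v" if "s \<ge> 0" for s
    using traj that unfolding is_trajectory_def v_def by blast+
  have vi: "v integrable_on {0..s}" if "s \<ge> 0" for s
    using v[OF that] by (simp add: absolutely_integrable_on_def)
  have incr: "x d - x c = integral {c..d} v" if "0 \<le> c" "c \<le> d" for c d
    using xs[of c] xs[of d] Henstock_Kurzweil_Integration.integral_combine[of 0 c d v] vi that
    by (simp add: algebra_simps)
  obtain h' where h: "\<And>y. (h has_derivative blinfun_apply (h' y)) (at y)" and h': "continuous_on UNIV h'"
    using C1 unfolding continuously_differentiable_def by blast
  have "continuous_on {0..t} (\<lambda>s. x 0 + integral {0..s} v)"
    using vi \<open>t \<ge> 0\<close> by (intro continuous_intros indefinite_integral_continuous_1) auto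
  then have "continuous_on {0..t} x"
    by (rule continuous_on_eq) (simp flip: xs)
  moreover have "continuous_on UNIV h"
    using has_derivative_continuous[OF h] by (simp add: continuous_on_eq_continuous_at)
  ultimately have "continuous_on {0..t} (\<lambda>s. h (x s))"
    using continuous_on_compose2[of UNIV h] by simp
  then have "closed {s \<in> {0..t}. 0 \<le> h (x s)}"
    by (intro continuous_on_closed_Collect_le continuous_on_const) auto
  then have "compact {s \<in> {0..t}. 0 \<le> h (x s)}"
    unfolding compact_eq_bounded_closed
    by (intro conjI bounded_subset[OF bounded_closed_interval[of 0 t]]) auto
  moreover have "{s \<in> {0..t}. 0 \<le> h (x s)} \<noteq> {}"
    using init \<open>t \<ge> 0\<close> by auto
  ultimately obtain c where c: "0 \<le> c" "c \<le> t" "h (x c) \<ge> 0"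
    and last: "\<And>s. \<lbrakk>0 \<le> s; s \<le> t; h (x s) \<ge> 0\<rbrakk> \<Longrightarrow> s \<le> c"
    using compact_attains_sup[of "{s \<in> {0..t}. 0 \<le> h (x s)}"] by auto
  have "v absolutely_integrable_on {c..t}"
    using v[OF \<open>t \<ge> 0\<close>] by (rule set_integrable_subset) (use c in auto)
  then have "((\<lambda>s. h' (x s) (v s)) has_integral h (x t) - h (x c)) {c..t}"
    using c by (intro has_integral_C1_compose_indefinite_integral h h') (auto intro: incr)
  \<comment> \<open>At \<open>c\<close> itself \<open>h\<close> is nonnegative, so the barrier
    condition does not fix the sign of the integrand there; changing it at one point leaves the
    integral alone.\<close>
  then have "((\<lambda>s. if s = c then 0 else h' (x s) (v s)) has_integral h (x t) - h (x c)) {c..t}"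
    by (rule has_integral_spike_finite[of "{c}", rotated 2]) auto
  then have "0 \<le> h (x t) - h (x c)"
  proof (rule has_integral_nonneg)
    fix s assume s: "s \<in> {c..t}"
    show "0 \<le> (if s = c then 0 else h' (x s) (v s))"
    proof (cases "s = c")
      case False
      then have "h (x s) < 0" using last[of s] s c by force
      then have "\<beta> (h (x s)) < 0"
        using \<beta> unfolding class_K_def by (metis strict_mono_less)
      then show ?thesis
        using barrier[of s] lie_f_plus_lie_g[OF h, of f "x s" g "u s"] s c by (simp add: v_def)
    qed simp
  qed
  then show False using c neg by simp
qed

lemma P_feasible_at_iff:
  assumes "u_min \<le> u_max" and Lgb: "lie_g g b x \<le> 0"
  shows "P_feasible_at f g u_min u_max b \<alpha> x_star \<epsilon> x \<longleftrightarrow> b_F f g u_min b \<alpha> x \<ge> 0"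
proof
  assume "P_feasible_at f g u_min u_max b \<alpha> x_star \<epsilon> x"
  then obtain u where u: "u \<in> K_cbf f g b \<alpha> x" "u_min \<le> u"
    unfolding P_feasible_at_def by auto
  have "lie_g g b x \<bullet> u \<le> lie_g g b x \<bullet> u_min"
    unfolding inner_vec_def
    using u(2) Lgb by (auto simp: less_eq_vec_def intro!: sum_mono mult_left_mono_neg)
  then show "b_F f g u_min b \<alpha> x \<ge> 0"
    using u(1) by (simp add: K_cbf_def b_F_def)
next
  assume "b_F f g u_min b \<alpha> x \<ge> 0"
  then have "u_min \<in> K_cbf f g b \<alpha> x"
    by (simp add: K_cbf_def b_F_def)
  \<comment> \<open>The relaxation \<delta> is free: take it equal to the left side of its
    constraint at \<open>u_min\<close>.\<close>
  then show "P_feasible_at f g u_min u_max b \<alpha> x_star \<epsilon> x"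
    unfolding P_feasible_at_def using assms(1) by auto
qed

theorem theorem3:
  fixes f :: "real^'n \<Rightarrow> real^'n" and g :: "real^'n \<Rightarrow> real^'q^'n"
    and X :: "(real^'n) set" and u_min u_max :: "real^'q"
    and b \<phi> :: "real^'n \<Rightarrow> real" and \<alpha> \<alpha>_f \<alpha>_u :: "real \<Rightarrow> real"
    and x_star :: "real^'n" and \<epsilon> \<gamma> :: real
    and x :: "real \<Rightarrow> real^'n" and u :: "real \<Rightarrow> real^'q"
  assumes f_lipschitz: "local_lipschitz UNIV UNIV (\<lambda>_::real. f)"
    and g_lipschitz: "local_lipschitz UNIV UNIV (\<lambda>_::real. g)"
    and b_C1: "continuously_differentiable b"
    and b_degree: "has_relative_degree f g X 1 (\<lambda>x u. b x)"
    and Lgb_sign: "\<forall>x\<in>X. lie_g g b x \<le> 0"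
    and class_K: "class_K \<alpha>" "class_K \<alpha>_f" "class_K \<alpha>_u"
    and eps: "\<epsilon> > 0"
    and b_F_C1: "continuously_differentiable (b_F f g u_min b \<alpha>)"
    and candidate: "candidate_function f g X u_min b \<alpha> \<alpha>_f (\<lambda>x u. \<phi> x)"
    and phi_degree: "has_relative_degree f g X 1 (\<lambda>x u. \<phi> x)"
    and phi_init: "\<phi> (x 0) \<ge> 0"
    and Lf_phi: "\<forall>x\<in>X. lie_f f \<phi> x \<ge> 0"
    and gamma: "\<gamma> > 0"
    and Lg_phi: "\<forall>x\<in>X. lie_g g \<phi> x = \<gamma> *\<^sub>R lie_g g b x"
    and zero_in_U: "0 \<in> {u_min..u_max}"
    and trajectory: "is_trajectory f g X u x"
    and P_initially_feasible: "P_feasible_at f g u_min u_max b \<alpha> x_star \<epsilon> (x 0)"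
    and u_in_K: "\<forall>t\<ge>0. u t \<in> K_cbf f g b \<alpha> (x t)"
    and u_in_U_s: "\<forall>t\<ge>0. u t \<in> U_s f g \<phi> \<alpha>_u (x t)"
  shows "\<forall>t\<ge>0. P_feasible_at f g u_min u_max b \<alpha> x_star \<epsilon> (x t)"
proof -
  \<comment> \<open>That 0 is admissible makes the box nonempty, so its corner \<open>u_min\<close>
    is an admissible control.\<close>
  have box: "u_min \<le> u_max"
    using zero_in_U by (meson atLeastAtMost_iff order_trans)
  have X: "x t \<in> X" if "t \<ge> 0" for t
    using trajectory that unfolding is_trajectory_def by blast
  have feasible_iff: "P_feasible_at f g u_min u_max b \<alpha> x_star \<epsilon> (x t) \<longleftrightarrow> b_F f g u_min b \<alpha> (x t) \<ge> 0"
    if "t \<ge> 0" for t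
    using P_feasible_at_iff[OF box] Lgb_sign X[OF that] by blast
  \<comment> \<open>Relative degree one provides some differentiable \<open>h\<close> that agrees
    with \<phi> as a function of state and control; extensionality identifies the two.\<close>
  obtain h where "(\<lambda>x (u :: real^'q). \<phi> x) = (\<lambda>x u. h x)" "continuously_differentiable h"
    using phi_degree by auto
  then have phi_C1: "continuously_differentiable \<phi>"
    by (metis ext)
  have phi: "\<phi> (x t) \<ge> 0" if "t \<ge> 0" for t
    by (rule is_trajectory_nonneg_invariant[OF trajectory phi_C1 class_K(3)])
      (use that phi_init u_in_U_s in \<open>auto simp: U_s_def\<close>)
  \<comment> \<open>In the rewritten form, the constraint of \<open>K_F\<close> is the barrier
    constraint with \<phi> added to its nonnegative side.\<close>
  have u_in_K_F: "u t \<in> K_F f g u_min b \<alpha> \<alpha>_f (x t)" if "t \<ge> 0" for t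
  proof -
    have "K_F f g u_min b \<alpha> \<alpha>_f (x t) =
        {w. lie_f f b (x t) + lie_g g b (x t) \<bullet> w + \<alpha> (b (x t)) + \<phi> (x t) \<ge> 0}"
      using candidate X[OF that] unfolding candidate_function_def by blast
    moreover have "lie_f f b (x t) + lie_g g b (x t) \<bullet> u t + \<alpha> (b (x t)) \<ge> 0"
      using u_in_K that by (auto simp: K_cbf_def)
    ultimately show ?thesis
      using phi[OF that] by simp
  qed
  \<comment> \<open>The invariance lemma applies again, now to \<open>b_F\<close>: membership in
    \<open>K_F\<close> is its barrier condition, and feasibility at time 0 gives the initial
    sign.\<close>
  have "b_F f g u_min b \<alpha> (x t) \<ge> 0" if "t \<ge> 0" for t
    by (rule is_trajectory_nonneg_invariant[OF trajectory b_F_C1 class_K(2)])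
      (use that u_in_K_F P_initially_feasible feasible_iff[of 0] in \<open>auto simp: K_F_def\<close>)
  then show ?thesis
    using feasible_iff by simp
qed

end
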